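(* Consider quadratic programs $$(\mathrm{P})\qquad \min_{x\in\mathbb{R}^n} f(x)\quad\text{s.t.}\quad g(x)\le 0,\quad h(x)\le 0,$$ where $f(x)=x^TAx+2a^Tx+a_0$, $g(x)=x^TBx+2b^Tx+b_0$, $h(x)=x^TCx+2c^Tx+c_0$ with $A,B,C\in\mathbb{R}^{n\times n}$ symmetric, $a,b,c\in\mathbb{R}^n$, $a_0,b_0,c_0\in\mathbb{R}$. With the classes [YZ], [GTRS], [QP1EQC], [QP1QC] and [Non-Alter] of such problems as defined in the context, one has $$\Big(\text{[YZ]}\cup\text{[GTRS]}\cup\text{[QP1EQC]}\cup\text{[QP1QC]}\Big)\subset\text{[Non-Alter]}.$$
   Context: For $\phi:\mathbb{R}^n\to\mathbb{R}$ and $\star\in\{<,\le,=,\ge,>\}$ write $\{\phi\star 0\}=\{x\in\mathbb{R}^n:\phi(x)\star 0\}$. Let $\mathcal{D}=\{g\le 0\}\cap\{h\le 0\}$. [Non-Alter]: the class of problems (P) satisfying both of the following. Assumption 1: if $\mathcal{D}\subset\{g=0\}$ then $\mathcal{D}=\{g=0\}$; and if $\mathcal{D}\subset\{h=0\}$ then $\mathcal{D}=\{h=0\}$. Assumption 2: either $\{g=0\}\subset\{h\le 0\}$ or $\{g=0\}\subset\{h\ge 0\}$; and either $\{h=0\}\subset\{g\le 0\}$ or $\{h=0\}\subset\{g\ge 0\}$. [QP1QC]: problems (P) with $h(x)\equiv -1$, so that (P) is $\min\{f(x): q(x)\le 0\}$ with $q=g$ an arbitrary quadratic function. [QP1EQC]: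 problems (P) with $h=-g$, so that (P) is $\min\{f(x): g(x)=0\}$. [GTRS]: problems $\min\{f(x): l\le q(x)\le u\}$ with $q$ a quadratic function and reals $l\le u$, written in the form (P) with $g=q-u$ and $h=l-q$. [YZ]: problems (P) such that (i) the semidefinite relaxation (SP) and its conic dual (SD) below both satisfy the Slater condition; (ii) $g$ and $h$ have no common root, i.e. $\{g=0\}\cap\{h=0\}=\emptyset$; (iii) $\{h\ge 0\}\subset\{g\le 0\}$. Here, with $$M(f)=\begin{bmatrix} a_0 & a^T \\ a & A \end{bmatrix},\quad M(g)=\begin{bmatrix} b_0 & b^T \\ b & B \end{bmatrix},\quad M(h)=\begin{bmatrix} c_0 & c^T \\ c & C \end{bmatrix},$$ $U\bullet V=\mathrm{trace}(U^TV)$, and $E$ the $(n+1)\times(n+1)$ matrix whose only nonzero entry is a $1$ in the upper-left (index $00$) position, (SP): $\min M(f)\bullet X$ subject to $M(g)\bullet X\le 0$, $M(h)\bullet X\le 0$, $X_{00}=1$, $X\succeq 0$; (SD): $\max\gamma$ subject to $Z=M(f)-\gamma E+\alpha M(g)+\beta M(h)\succeq 0$, $\alpha\ge 0$, $\beta\ge 0$. The Slater condition for (SP) means there is $X\succ 0$ with $X_{00}=1$, $M(g)\bullet X<0$, $M(h)\bullet X<0$; the Slater condition for (SD) means there are $\gamma\in\mathbb{R}$ and $\tilde\alpha\ge 0,\tilde\beta\ge 0$ with $M(f)-\gamma E+\tilde\alpha M(g)+\tilde\beta M(h)\succ 0$. *)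

theory Defs
  imports "HOL-Analysis.Analysis"
begin

text \<open>Coefficient data of a quadratic function \<open>x\<^sup>T A x + 2 a\<^sup>T x + a\<^sub>0\<close> on \<open>real ^ 'n\<close>.
  The matrix may be zero, so affine and constant functions are included.\<close>

record ('n::finite) quad =
  quad_mat :: "real ^ 'n ^ 'n"
  lin_vec :: "real ^ 'n"
  const_term :: real

definition sym_quad :: "('n::finite) quad \<Rightarrow> bool" where
  "sym_quad p \<longleftrightarrow> transpose (quad_mat p) = quad_mat p"

definition qeval :: "('n::finite) quad \<Rightarrow> real ^ 'n \<Rightarrow> real" where
  "qeval p x = x \<bullet> (quad_mat p *v x) + 2 * (lin_vec p \<bullet> x) + const_term p"

text \<open>An instance of \<open>min f(x)\<close> subject to \<open>g(x) \<le> 0\<close>, \<open>h(x) \<le> 0\<close>.\<close>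

record ('n::finite) qp =
  obj :: "'n quad"
  gcon :: "'n quad"
  hcon :: "'n quad"

definition QP :: "('n::finite) qp set" where
  "QP = {P. sym_quad (obj P) \<and> sym_quad (gcon P) \<and> sym_quad (hcon P)}"

definition feasible_set :: "('n::finite) qp \<Rightarrow> (real ^ 'n) set" where
  "feasible_set P = {x. qeval (gcon P) x \<le> 0} \<inter> {x. qeval (hcon P) x \<le> 0}"

definition assumption1 :: "('n::finite) qp \<Rightarrow> bool" where
  "assumption1 P \<longleftrightarrow>
     (feasible_set P \<subseteq> {x. qeval (gcon P) x = 0} \<longrightarrow>
        feasible_set P = {x. qeval (gcon P) x = 0}) \<and>
     (feasible_set P \<subseteq> {x. qeval (hcon P) x = 0} \<longrightarrow>
        feasible_set P = {x. qeval (hcon P) x = 0})"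

definition assumption2 :: "('n::finite) qp \<Rightarrow> bool" where
  "assumption2 P \<longleftrightarrow>
     ({x. qeval (gcon P) x = 0} \<subseteq> {x. qeval (hcon P) x \<le> 0} \<or>
      {x. qeval (gcon P) x = 0} \<subseteq> {x. qeval (hcon P) x \<ge> 0}) \<and>
     ({x. qeval (hcon P) x = 0} \<subseteq> {x. qeval (gcon P) x \<le> 0} \<or>
      {x. qeval (hcon P) x = 0} \<subseteq> {x. qeval (gcon P) x \<ge> 0})"

definition Non_Alter :: "('n::finite) qp set" where
  "Non_Alter = {P \<in> QP. assumption1 P \<and> assumption2 P}"

definition QP1QC :: "('n::finite) qp set" where
  "QP1QC = {P \<in> QP. \<forall>x. qeval (hcon P) x = - 1}"

definition QP1EQC :: "('n::finite) qp set" where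
  "QP1EQC = {P \<in> QP. \<forall>x. qeval (hcon P) x = - qeval (gcon P) x}"

definition GTRS :: "('n::finite) qp set" where
  "GTRS = {P \<in> QP. \<exists>q l u. sym_quad q \<and> l \<le> u \<and>
     (\<forall>x. qeval (gcon P) x = qeval q x - u) \<and>
     (\<forall>x. qeval (hcon P) x = l - qeval q x)}"

text \<open>Matrices of order \<open>n + 1\<close> are indexed by \<open>'n option\<close>; \<open>None\<close> is the index \<open>0\<close>.\<close>

definition hom_mat :: "('n::finite) quad \<Rightarrow> real ^ 'n option ^ 'n option" where
  "hom_mat p = (\<chi> i j. case (i, j) of
      (None, None) \<Rightarrow> const_term p
    | (None, Some l) \<Rightarrow> lin_vec p $ l
    | (Some k, None) \<Rightarrow> lin_vec p $ k
    | (Some k, Some l) \<Rightarrow> quad_mat p $ k $ l)"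

definition E00 :: "real ^ ('n::finite) option ^ 'n option" where
  "E00 = (\<chi> i j. if i = None \<and> j = None then 1 else 0)"

definition mat_inner :: "real ^ 'm ^ 'm \<Rightarrow> real ^ 'm ^ 'm \<Rightarrow> real" where
  "mat_inner U V = trace (transpose U ** V)"

definition pos_def :: "real ^ 'm ^ 'm \<Rightarrow> bool" where
  "pos_def U \<longleftrightarrow> transpose U = U \<and> (\<forall>v. v \<noteq> 0 \<longrightarrow> v \<bullet> (U *v v) > 0)"

text \<open>Strict feasibility of the semidefinite relaxation: minimise \<open>M(f) \<bullet> X\<close> subject to
  \<open>M(g) \<bullet> X \<le> 0\<close>, \<open>M(h) \<bullet> X \<le> 0\<close>, \<open>X\<^sub>0\<^sub>0 = 1\<close> and \<open>X\<close> positive semidefinite.\<close>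

definition slater_SP :: "('n::finite) qp \<Rightarrow> bool" where
  "slater_SP P \<longleftrightarrow> (\<exists>X. pos_def X \<and> X $ None $ None = 1 \<and>
     mat_inner (hom_mat (gcon P)) X < 0 \<and> mat_inner (hom_mat (hcon P)) X < 0)"

text \<open>Strict feasibility of its conic dual: maximise \<open>\<gamma>\<close> subject to \<open>\<alpha>, \<beta> \<ge> 0\<close> and
  \<open>M(f) - \<gamma> E + \<alpha> M(g) + \<beta> M(h)\<close> positive semidefinite. Only the conic constraint is
  required to hold strictly.\<close>

definition slater_SD :: "('n::finite) qp \<Rightarrow> bool" where
  "slater_SD P \<longleftrightarrow> (\<exists>\<gamma> \<alpha> \<beta>. \<alpha> \<ge> 0 \<and> \<beta> \<ge> 0 \<and>
     pos_def (hom_mat (obj P) - \<gamma> *\<^sub>R E00 + \<alpha> *\<^sub>R hom_mat (gcon P) + \<beta> *\<^sub>R hom_mat (hcon P)))"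

definition YZ :: "('n::finite) qp set" where
  "YZ = {P \<in> QP. slater_SP P \<and> slater_SD P \<and>
     {x. qeval (gcon P) x = 0} \<inter> {x. qeval (hcon P) x = 0} = {} \<and>
     {x. qeval (hcon P) x \<ge> 0} \<subseteq> {x. qeval (gcon P) x \<le> 0}}"

end

theory Submission
  imports Defs
begin

text \<open>Only the class [YZ] needs more than unfolding. Suppose that \<open>g\<close> vanishes at a point where
  \<open>h > 0\<close> and at a point where \<open>h < 0\<close>. On the line through them \<open>g\<close> is a quadratic polynomial
  with these two roots, and it cannot change sign at the first root, since \<open>g \<le> 0\<close> wherever
  \<open>h \<ge> 0\<close>. So \<open>g\<close> vanishes on the line, and the intermediate value theorem for \<open>h\<close> yields a
  common root. For the first half of Assumption 1, if all feasible points are roots of \<open>g\<close>, then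
  \<open>h\<close> has no root and thus a constant sign. The sign cannot be positive: otherwise the homogenized
  matrix of \<open>h\<close> is positive semidefinite and has nonnegative inner product with
  every positive definite \<open>X\<close>, against the Slater condition for (SP).\<close>

section \<open>Positive semidefinite matrices and the trace inner product\<close>

definition pos_semidef :: "real ^ 'm ^ 'm \<Rightarrow> bool" where
  "pos_semidef U \<longleftrightarrow> transpose U = U \<and> (\<forall>v. v \<bullet> (U *v v) \<ge> 0)"

lemma pos_def_imp_pos_semidef: "pos_def U \<Longrightarrow> pos_semidef U"
  unfolding pos_def_def pos_semidef_def
  by (metis inner_zero_left less_eq_real_def)

lemma mat_inner_eq_sum: "mat_inner U V = (\<Sum>i\<in>UNIV. \<Sum>j\<in>UNIV. U $ i $ j * V $ i $ j)"
  unfolding mat_inner_def trace_def transpose_def matrix_matrix_mult_def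
  by (simp, rule sum.swap)

lemma inner_matrix_vector_eq_sum:
  fixes U :: "real ^ 'm ^ 'm"
  shows "v \<bullet> (U *v w) = (\<Sum>i\<in>UNIV. \<Sum>j\<in>UNIV. U $ i $ j * (v $ i * w $ j))"
  unfolding inner_vec_def matrix_vector_mult_def
  by (simp add: sum_distrib_left mult_ac)

lemma inner_axis_matrix_vector:
  fixes U :: "real ^ 'm ^ 'm"
  shows "axis s 1 \<bullet> (U *v w) = row s U \<bullet> w"
  by (simp add: inner_axis' matrix_vector_mul_component row_def)

lemma symmetric_inner_commute:
  fixes U :: "real ^ 'm ^ 'm"
  assumes "transpose U = U"
  shows "v \<bullet> (U *v w) = w \<bullet> (U *v v)"
  by (metis assms dot_lmul_matrix inner_commute transpose_matrix_vector)

lemma quadratic_nonneg_imp_leading_nonneg: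
  fixes \<alpha> \<beta> \<gamma> :: real
  assumes "\<And>t. \<alpha> * t\<^sup>2 + \<beta> * t + \<gamma> \<ge> 0"
  shows "\<alpha> \<ge> 0"
proof (rule ccontr)
  assume "\<not> \<alpha> \<ge> 0"
  then have \<alpha>: "\<alpha> < 0" by simp
  \<comment> \<open>Chosen so that \<open>\<alpha> * t\<close> outweighs both lower coefficients;
    the summand 1 gives \<open>t \<ge> 1\<close>.\<close>
  define t where "t = 1 + (\<bar>\<beta>\<bar> + \<bar>\<gamma>\<bar>) / (- \<alpha>)"
  have t: "t \<ge> 1" and e: "\<alpha> * t = \<alpha> - \<bar>\<beta>\<bar> - \<bar>\<gamma>\<bar>"
    using \<alpha> by (auto simp: t_def field_simps)
  have "\<alpha> * t\<^sup>2 + \<beta> * t + \<gamma> = (\<alpha> * t + \<beta>) * t + \<gamma>"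
    by (simp add: power2_eq_square algebra_simps)
  also have "\<dots> = (\<alpha> - \<bar>\<beta>\<bar> - \<bar>\<gamma>\<bar> + \<beta>) * t + \<gamma>"
    by (simp only: e)
  also have "\<dots> \<le> (\<alpha> - \<bar>\<gamma>\<bar>) * t + \<gamma>"
    using t by (intro add_right_mono mult_right_mono) auto
  also have "\<dots> \<le> (\<alpha> - \<bar>\<gamma>\<bar>) * 1 + \<gamma>"
    using t \<alpha> by (intro add_right_mono mult_left_mono_neg) auto
  also have "\<dots> < 0" using \<alpha> by simp
  finally show False using assms[of t] by simp
qed

lemma linear_nonneg_imp_slope_zero:
  fixes \<beta> \<gamma> :: real
  assumes "\<And>t. \<beta> * t + \<gamma> \<ge> 0"
  shows "\<beta> = 0"
proof (rule ccontr)
  assume "\<beta> \<noteq> 0"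
  then have "\<beta> * (- (\<gamma> + 1) / \<beta>) + \<gamma> = - 1" by simp
  with assms show False by (metis neg_0_le_iff_le not_one_le_zero)
qed

lemma inner_matrix_vector_add_scaleR:
  fixes U :: "real ^ 'm ^ 'm"
  shows "(v + t *\<^sub>R w) \<bullet> (U *v (v + t *\<^sub>R w)) =
    v \<bullet> (U *v v) + t * (v \<bullet> (U *v w) + w \<bullet> (U *v v)) + t\<^sup>2 * (w \<bullet> (U *v w))"
  by (simp add: matrix_vector_right_distrib matrix_vector_mult_scaleR inner_add_left
      inner_add_right power2_eq_square algebra_simps)

text \<open>On the line through \<open>axis j 1\<close> in direction \<open>axis s 1\<close> the
  form has no square term, so it is affine and bounded below; its slope, twice the entry in
  question, must vanish.\<close>

lemma pos_semidef_zero_diagonal: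
  fixes U :: "real ^ 'm ^ 'm"
  assumes "pos_semidef U" "U $ s $ s = 0"
  shows "U $ s $ j = 0"
proof -
  have sym: "transpose U = U" and nonneg: "\<And>v. v \<bullet> (U *v v) \<ge> 0"
    using assms(1) by (auto simp: pos_semidef_def)
  have entry: "axis i 1 \<bullet> (U *v axis k 1) = U $ i $ k" for i k
    by (simp add: inner_axis_matrix_vector row_def inner_axis)
  have "U $ j $ s = U $ s $ j"
    using sym by (metis transpose_def vec_lambda_beta)
  then have "2 * U $ s $ j * t + U $ j $ j \<ge> 0" for t
    using nonneg[of "axis j 1 + t *\<^sub>R axis s 1"]
    unfolding inner_matrix_vector_add_scaleR entry assms(2)
    by (simp add: algebra_simps)
  then show ?thesis using linear_nonneg_imp_slope_zero by fastforce
qed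

text \<open>One step of Cholesky elimination: the Schur complement of a diagonal entry.\<close>

lemma pos_semidef_schur_complement:
  fixes U :: "real ^ 'm ^ 'm"
  assumes "pos_semidef U" "U $ s $ s \<noteq> 0"
  shows "pos_semidef (\<chi> i j. U $ i $ j - U $ s $ i * U $ s $ j / U $ s $ s)"
    (is "pos_semidef ?V")
proof -
  have sym: "transpose U = U" and nonneg: "\<And>v. v \<bullet> (U *v v) \<ge> 0"
    using assms(1) by (auto simp: pos_semidef_def)
  have "U $ i $ j = U $ j $ i" for i j
    using sym by (metis transpose_def vec_lambda_beta)
  then have "transpose ?V = ?V"
    by (simp add: transpose_def vec_eq_iff)
  moreover have "v \<bullet> (?V *v v) \<ge> 0" for v
  proof -
    define r where "r = row s U \<bullet> v"
    have r: "r = (\<Sum>i\<in>UNIV. U $ s $ i * v $ i)"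
      by (simp add: r_def row_def inner_vec_def)
    have "v \<bullet> (?V *v v) = v \<bullet> (U *v v) -
        (\<Sum>i\<in>UNIV. \<Sum>j\<in>UNIV. U $ s $ i * U $ s $ j / U $ s $ s * (v $ i * v $ j))"
      unfolding inner_matrix_vector_eq_sum by (simp add: left_diff_distrib sum_subtractf)
    also have "(\<Sum>i\<in>UNIV. \<Sum>j\<in>UNIV. U $ s $ i * U $ s $ j / U $ s $ s * (v $ i * v $ j)) =
        r * r / U $ s $ s"
      unfolding r sum_product sum_divide_distrib by (simp add: mult_ac)
    finally have V: "v \<bullet> (?V *v v) = v \<bullet> (U *v v) - r * r / U $ s $ s" .
    have "axis s 1 \<bullet> (U *v axis s 1) = U $ s $ s"
      by (simp add: inner_axis_matrix_vector row_def inner_axis)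
    \<comment> \<open>This shift of \<open>v\<close> along \<open>axis s 1\<close> completes the
      square, so the form of the complement at \<open>v\<close> is the form of \<open>U\<close> at
      the shifted vector.\<close>
    then have "(v + (- r / U $ s $ s) *\<^sub>R axis s 1) \<bullet>
        (U *v (v + (- r / U $ s $ s) *\<^sub>R axis s 1)) = v \<bullet> (U *v v) - r * r / U $ s $ s"
      unfolding inner_matrix_vector_add_scaleR symmetric_inner_commute[OF sym, of v "axis s 1"]
      using assms(2) by (simp add: inner_axis_matrix_vector r_def[symmetric] field_simps power2_eq_square)
    then show ?thesis
      using V nonneg[of "v + (- r / U $ s $ s) *\<^sub>R axis s 1"] by simp
  qed
  ultimately show ?thesis by (simp add: pos_semidef_def)
qed

text \<open>Induction on a set of indices containing all nonzero rows of \<open>X\<close>. Each step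
  splits off a rank-one matrix, whose inner product with \<open>M\<close> is a value of the form of
  \<open>M\<close> over a positive pivot, and leaves a Schur complement with smaller
  support.\<close>

lemma mat_inner_nonneg_of_support:
  fixes M :: "real ^ 'm ^ 'm"
  assumes M: "\<And>v. v \<bullet> (M *v v) \<ge> 0"
  assumes "finite S" "pos_semidef X" "\<And>i j. i \<notin> S \<Longrightarrow> X $ i $ j = 0"
  shows "mat_inner M X \<ge> 0"
  using assms(2-)
proof (induction S arbitrary: X rule: finite_induct)
  case empty
  then show ?case by (simp add: mat_inner_eq_sum)
next
  case (insert s S)
  show ?case
  proof (cases "X $ s $ s = 0")
    case True
    then have "X $ s $ j = 0" for j
      using pos_semidef_zero_diagonal insert.prems(1) by blast
    with insert show ?thesis by (metis insertE)
  next
    case False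
    define Y where "Y = (\<chi> i j. X $ i $ j - X $ s $ i * X $ s $ j / X $ s $ s)"
    have sym: "X $ i $ j = X $ j $ i" for i j
      using insert.prems(1) unfolding pos_semidef_def by (metis transpose_def vec_lambda_beta)
    have "Y $ i $ j = 0" if "i \<notin> S" for i j
    proof (cases "i = s")
      case True
      with False show ?thesis by (simp add: Y_def)
    next
      case i: False
      \<comment> \<open>Row \<open>i\<close> of \<open>X\<close> is zero; by symmetry so is the
        factor \<open>X $ s $ i\<close> of the correction.\<close>
      with that insert.prems(2)[of i] sym[of s i] show ?thesis by (simp add: Y_def)
    qed
    moreover have "pos_semidef Y"
      unfolding Y_def using pos_semidef_schur_complement insert.prems(1) False by blast
    ultimately have Y: "mat_inner M Y \<ge> 0" by (intro insert.IH)
    have "0 \<le> axis s 1 \<bullet> (X *v axis s 1)"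
      using insert.prems(1) by (simp add: pos_semidef_def)
    then have pos: "X $ s $ s \<ge> 0"
      by (simp add: inner_axis_matrix_vector row_def inner_axis)
    have "mat_inner M X = mat_inner M Y + (row s X \<bullet> (M *v row s X)) / X $ s $ s"
      unfolding mat_inner_eq_sum inner_matrix_vector_eq_sum sum_divide_distrib
        sum.distrib[symmetric]
      by (intro sum.cong refl) (simp add: Y_def row_def algebra_simps)
    with Y M pos show ?thesis by simp
  qed
qed

lemma mat_inner_pos_semidef_nonneg:
  fixes M :: "real ^ 'm ^ 'm"
  assumes "\<And>v. v \<bullet> (M *v v) \<ge> 0" "pos_semidef X"
  shows "mat_inner M X \<ge> 0"
  using mat_inner_nonneg_of_support[of M UNIV X] assms by simp

section \<open>Homogenization of quadratic functions\<close>

lemma sum_UNIV_option: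
  fixes F :: "('n::finite) option \<Rightarrow> 'a::comm_monoid_add"
  shows "(\<Sum>i\<in>UNIV. F i) = F None + (\<Sum>k\<in>UNIV. F (Some k))"
  by (simp add: UNIV_option_conv sum.reindex)

lemma hom_mat_quadratic_form:
  fixes v :: "real ^ ('n::finite) option"
  defines "y \<equiv> \<chi> k. v $ Some k"
  shows "v \<bullet> (hom_mat p *v v) =
    y \<bullet> (quad_mat p *v y) + 2 * v $ None * (lin_vec p \<bullet> y) + const_term p * (v $ None)\<^sup>2"
  unfolding inner_matrix_vector_eq_sum sum_UNIV_option
  by (simp add: hom_mat_def y_def inner_vec_def sum.distrib sum_distrib_left
      power2_eq_square algebra_simps)

lemma qeval_line:
  "qeval p (x + t *\<^sub>R d) = (d \<bullet> (quad_mat p *v d)) * t\<^sup>2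
    + (x \<bullet> (quad_mat p *v d) + d \<bullet> (quad_mat p *v x) + 2 * (lin_vec p \<bullet> d)) * t + qeval p x"
  unfolding qeval_def inner_matrix_vector_add_scaleR
  by (simp add: inner_add_right algebra_simps)

text \<open>If the coordinate \<open>v $ None\<close> is nonzero, rescaling by it turns the form
  into a positive multiple of a value of \<open>p\<close>. At infinity, where it is zero, the form
  is the leading coefficient of \<open>p\<close> along a line through the origin.\<close>

lemma hom_mat_nonneg_of_qeval_nonneg:
  fixes p :: "('n::finite) quad"
  assumes "\<And>x. qeval p x \<ge> 0"
  shows "v \<bullet> (hom_mat p *v v) \<ge> 0"
proof -
  define y :: "real ^ 'n" where "y = (\<chi> k. v $ Some k)"
  define t where "t = v $ None"
  have form: "v \<bullet> (hom_mat p *v v) =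
      y \<bullet> (quad_mat p *v y) + 2 * t * (lin_vec p \<bullet> y) + const_term p * t\<^sup>2"
    unfolding y_def t_def by (rule hom_mat_quadratic_form)
  show ?thesis
  proof (cases "t = 0")
    case True
    have "y \<bullet> (quad_mat p *v y) \<ge> 0"
      using assms[of "0 + s *\<^sub>R y" for s] unfolding qeval_line
      by (rule quadratic_nonneg_imp_leading_nonneg)
    with True form show ?thesis by simp
  next
    case False
    then have "v \<bullet> (hom_mat p *v v) = t\<^sup>2 * qeval p ((1 / t) *\<^sub>R y)"
      unfolding form qeval_def
      by (simp add: matrix_vector_mult_scaleR field_simps power2_eq_square)
    with assms show ?thesis by simp
  qed
qed

lemma slater_SP_imp_ex_hcon_neg:
  assumes "slater_SP P"
  shows "\<exists>x. qeval (hcon P) x < 0"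
proof (rule ccontr)
  assume "\<not> ?thesis"
  then have "\<And>x. qeval (hcon P) x \<ge> 0" by (simp add: not_less)
  then have "mat_inner (hom_mat (hcon P)) X \<ge> 0" if "pos_def X" for X
    using that by (intro mat_inner_pos_semidef_nonneg hom_mat_nonneg_of_qeval_nonneg
        pos_def_imp_pos_semidef)
  with assms show False by (force simp: slater_SP_def)
qed

section \<open>Sign changes along a line\<close>

lemma qeval_line_continuous: "continuous_on T (\<lambda>t. qeval p (x + t *\<^sub>R d))"
  unfolding qeval_line by (intro continuous_intros)

lemma qeval_root_between:
  assumes "qeval p x > 0" "qeval p y < 0"
  obtains t where "qeval p (x + t *\<^sub>R (y - x)) = 0"
proof -
  have "\<exists>t\<ge>0. t \<le> 1 \<and> qeval p (x + t *\<^sub>R (y - x)) = 0"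
    using assms by (intro IVT2' qeval_line_continuous) auto
  with that show thesis by blast
qed

text \<open>Points on both sides of \<open>x\<close> are needed to test \<open>g\<close> around its
  root there; \<open>\<epsilon> < 1\<close> stays short of the second root, at parameter 1.\<close>

lemma qeval_pos_nearby_on_line:
  assumes "qeval p x > 0"
  obtains \<epsilon> where "0 < \<epsilon>" "\<epsilon> < 1"
    "qeval p (x + \<epsilon> *\<^sub>R d) > 0" "qeval p (x + (- \<epsilon>) *\<^sub>R d) > 0"
proof -
  have "open {t. qeval p (x + t *\<^sub>R d) > 0}"
    by (intro open_Collect_less qeval_line_continuous continuous_on_const)
  then obtain e where e: "e > 0" "ball 0 e \<subseteq> {t. qeval p (x + t *\<^sub>R d) > 0}"
    using assms openE[of _ "0::real"] by (metis (mono_tags) add.right_neutral mem_Collect_eq scale_zero_left)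
  define \<epsilon> where "\<epsilon> = min (e / 2) (1 / 2)"
  have \<epsilon>: "0 < \<epsilon>" "\<epsilon> < 1" "\<epsilon> < e"
    using e(1) by (auto simp: \<epsilon>_def)
  then have "\<epsilon> \<in> ball 0 e" "- \<epsilon> \<in> ball 0 e" by auto
  with e(2) \<epsilon> that show thesis by blast
qed

lemma common_root_of_sign_change:
  assumes sub: "\<And>z. qeval h z \<ge> 0 \<Longrightarrow> qeval g z \<le> 0"
    and g: "qeval g x = 0" "qeval g y = 0"
    and h: "qeval h x > 0" "qeval h y < 0"
  shows "\<exists>z. qeval g z = 0 \<and> qeval h z = 0"
proof -
  define \<alpha> where "\<alpha> = (y - x) \<bullet> (quad_mat g *v (y - x))"
  obtain \<beta> where \<beta>: "\<And>t. qeval g (x + t *\<^sub>R (y - x)) = \<alpha> * t\<^sup>2 + \<beta> * t"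
    unfolding qeval_line g(1) \<alpha>_def by (metis add.right_neutral)
  have "\<beta> = - \<alpha>" using \<beta>[of 1] g(2) by simp
  then have line: "qeval g (x + t *\<^sub>R (y - x)) = \<alpha> * (t * (t - 1))" for t
    unfolding \<beta> by (simp add: power2_eq_square algebra_simps)
  obtain \<epsilon> where \<epsilon>: "0 < \<epsilon>" "\<epsilon> < 1" "qeval h (x + \<epsilon> *\<^sub>R (y - x)) > 0"
      "qeval h (x + (- \<epsilon>) *\<^sub>R (y - x)) > 0"
    using qeval_pos_nearby_on_line[OF h(1)] by blast
  \<comment> \<open>The factor \<open>t * (t - 1)\<close> has opposite signs at
    \<open>\<epsilon>\<close> and \<open>- \<epsilon>\<close>, which bounds \<open>\<alpha>\<close>
    by 0 from both sides.\<close>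
  have "\<alpha> * (\<epsilon> * (\<epsilon> - 1)) \<le> 0" "\<alpha> * (- \<epsilon> * (- \<epsilon> - 1)) \<le> 0"
    using sub[of "x + \<epsilon> *\<^sub>R (y - x)"] sub[of "x + (- \<epsilon>) *\<^sub>R (y - x)"] \<epsilon>(3,4) unfolding line by auto
  moreover have "\<epsilon> * (\<epsilon> - 1) < 0" "- \<epsilon> * (- \<epsilon> - 1) > 0"
    using \<epsilon>(1,2) by (auto simp: mult_less_0_iff zero_less_mult_iff)
  ultimately have "\<alpha> = 0"
    by (metis linorder_neqE_linordered_idom mult_neg_neg mult_pos_pos not_le)
  moreover obtain t where "qeval h (x + t *\<^sub>R (y - x)) = 0"
    using qeval_root_between[OF h] .
  ultimately show ?thesis using line[of t] by auto
qed

section \<open>The four inclusions\<close>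

lemma YZ_subset_Non_Alter: "YZ \<subseteq> Non_Alter"
proof
  fix P :: "('n::finite) qp"
  assume P: "P \<in> YZ"
  let ?g = "qeval (gcon P)" and ?h = "qeval (hcon P)"
  from P have QP: "P \<in> QP" and slater: "slater_SP P"
    and no_common: "\<And>x. \<not> (?g x = 0 \<and> ?h x = 0)"
    and sub: "\<And>x. ?h x \<ge> 0 \<Longrightarrow> ?g x \<le> 0"
    by (auto simp: YZ_def)
  \<comment> \<open>This settles the second half of Assumption 1.\<close>
  have h_feasible: "{x. ?h x = 0} \<subseteq> feasible_set P"
    using sub by (auto simp: feasible_set_def)
  have "\<not> (\<exists>x y. ?g x = 0 \<and> ?g y = 0 \<and> ?h x > 0 \<and> ?h y < 0)"
    using common_root_of_sign_change[of "hcon P" "gcon P"] sub no_common by blast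
  then have "{x. ?g x = 0} \<subseteq> {x. ?h x \<le> 0} \<or> {x. ?g x = 0} \<subseteq> {x. ?h x \<ge> 0}"
    by (force simp: subset_iff not_le)
  moreover have "{x. ?h x = 0} \<subseteq> {x. ?g x \<le> 0}"
    using sub by auto
  ultimately have "assumption2 P" by (simp add: assumption2_def)
  moreover have "feasible_set P = {x. ?g x = 0}" if D: "feasible_set P \<subseteq> {x. ?g x = 0}"
  proof -
    obtain y where y: "?h y < 0"
      using slater_SP_imp_ex_hcon_neg[OF slater] by blast
    \<comment> \<open>A root of \<open>h\<close> would be feasible, hence by \<open>D\<close> also a
      root of \<open>g\<close>.\<close>
    have no_root: "?h x \<noteq> 0" for x
      using h_feasible D no_common by blast
    have "?h x \<le> 0" for x
      using qeval_root_between[of "hcon P" x y] y no_root by (meson not_le)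
    \<comment> \<open>With \<open>h \<le> 0\<close> everywhere, all roots of \<open>g\<close> are
      feasible.\<close>
    with D show ?thesis by (auto simp: feasible_set_def)
  qed
  ultimately show "P \<in> Non_Alter"
    using QP h_feasible by (auto simp: Non_Alter_def assumption1_def)
qed

text \<open>Since \<open>g + h\<close> is the constant \<open>l - u \<le> 0\<close>, a root of
  either function is feasible.\<close>

lemma GTRS_subset_Non_Alter: "GTRS \<subseteq> Non_Alter"
  by (auto simp: GTRS_def Non_Alter_def assumption1_def assumption2_def feasible_set_def)

text \<open>Here the feasible set and both zero sets coincide.\<close>

lemma QP1EQC_subset_Non_Alter: "QP1EQC \<subseteq> Non_Alter"
  by (auto simp: QP1EQC_def Non_Alter_def assumption1_def assumption2_def feasible_set_def)

text \<open>Here \<open>h\<close> has no roots and the feasible set is the sublevel set of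
  \<open>g\<close>, which contains the roots of \<open>g\<close>.\<close>

lemma QP1QC_subset_Non_Alter: "QP1QC \<subseteq> Non_Alter"
  by (auto simp: QP1QC_def Non_Alter_def assumption1_def assumption2_def feasible_set_def)

theorem mainTheorem4:
  shows "(YZ \<union> GTRS \<union> QP1EQC \<union> QP1QC :: ('n::finite) qp set) \<subseteq> Non_Alter"
  using YZ_subset_Non_Alter GTRS_subset_Non_Alter QP1EQC_subset_Non_Alter QP1QC_subset_Non_Alter
  by blast

end
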